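(* Let $q$ and $t$ be odd primes such that $q=4t+1$. Then $t\in\mathcal{S}_q$ and $\sqrt{t}\in\mathcal{S}_q$. Further: (i) $\mathcal{O}_q=\langle t\rangle$. (ii) If $q>13$, then $\mathcal{S}_q=\langle 4\rangle$ and $\mathcal{O}_q=\langle 16\rangle$.
   Context: $\mathbb{F}_q$ is the finite field with $q$ elements and $\mathbb{F}_q^*$ its multiplicative group. $\mathcal{S}_q=\{a^2 : a\in\mathbb{F}_q^*\}$ is the set of nonzero squares, and $\mathcal{O}_q=\{a\in\mathbb{F}_q^* : \text{the multiplicative order of } a \text{ is odd}\}$. $\langle a\rangle$ denotes the cyclic subgroup of $\mathbb{F}_q^*$ generated by $a$; integers are read as elements of $\mathbb{F}_q$. $\sqrt{t}$ denotes a square root of $t$ in $\mathbb{F}_q^*$ (either one). *)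

theory Defs
  imports "HOL-Computational_Algebra.Primes" "HOL-Algebra.Multiplicative_Group" "HOL-Algebra.Generated_Groups"
begin

definition nonzero_squares :: "('a, 'b) ring_scheme \<Rightarrow> 'a set" where
  "nonzero_squares R = {a [^]\<^bsub>mult_of R\<^esub> (2::nat) | a. a \<in> carrier (mult_of R)}"

definition odd_order_elements :: "('a, 'b) ring_scheme \<Rightarrow> 'a set" where
  "odd_order_elements R = {a \<in> carrier (mult_of R). odd (group.ord (mult_of R) a)}"

(* The image of an integer under the canonical ring homomorphism from the integers to R. *)
definition int_elem :: "('a, 'b) ring_scheme \<Rightarrow> int \<Rightarrow> 'a" where
  "int_elem R k = [k] \<cdot>\<^bsub>R\<^esub> \<one>\<^bsub>R\<^esub>"

end

theory Submission
  imports Defs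
begin

text \<open>
  As \<open>q = 4 t + 1\<close>, the identity \<open>4 t = -1\<close> holds in the field, so the powers of \<open>t\<close> are known
  once those of \<open>4\<close> are. The field contains some \<open>i\<close> with \<open>i^2 = -1\<close>, and \<open>(1 + i)^2 = 2 i\<close>.
  Raised to the power \<open>2 t\<close>, the left-hand side becomes \<open>(1 + i)^(4 t) = 1\<close>, and \<open>i^(2 t)\<close>
  becomes \<open>(-1)^t = -1\<close>; hence \<open>4^t = 2^(2 t) = -1\<close> (lemma \<open>four_pow_eq_minus_one\<close>). This is
  the supplementary law that \<open>2\<close> is not a square modulo a prime congruent to \<open>5\<close> modulo \<open>8\<close>.

  Consequently \<open>t^t = (-1)^t / 4^t = 1\<close> (lemma \<open>self_pow_eq_one\<close>), and as the exponent is prime,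
  the element \<open>t\<close> has order \<open>t\<close>. In the same way \<open>16 = 4^2\<close> has order \<open>t\<close>, and \<open>4\<close> has order
  \<open>2 t\<close>; the only possible obstruction, \<open>16 = 1\<close>, would need the prime \<open>q\<close>, which is at least
  \<open>13\<close>, to divide \<open>15\<close>.

  In a finite field, an element of order \<open>n\<close> generates the full group of \<open>n\<close>-th roots of unity,
  because the polynomial \<open>x^n - 1\<close> has at most \<open>n\<close> roots (lemma
  \<open>generate_eq_roots_of_unity\<close>). The unit group has order \<open>4 t\<close> with \<open>t\<close> odd, so its elements of
  odd order are the \<open>t\<close>-th roots of unity, and both \<open>t\<close> and \<open>16\<close> generate them. The squares
  lie among the \<open>2 t\<close>-th roots of unity, which are the powers of the square \<open>4\<close>, so the two sets
  agree (lemma \<open>nonzero_squares_eq_roots_of_unity\<close>). This form of Euler's criterion shows that \<open>t\<close>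
  and its square roots are squares, because their \<open>2 t\<close>-th powers are \<open>1\<close>.
\<close>

section \<open>Orders and roots of unity\<close>

lemma (in group) ord_eq_prime:
  assumes "x \<in> carrier G" "x [^] p = \<one>" "x \<noteq> \<one>" "prime (p::nat)"
  shows "ord x = p"
proof -
  have "ord x dvd p" using assms pow_eq_id by blast
  moreover have "ord x \<noteq> 1" using assms ord_eq_1 by blast
  ultimately show ?thesis using \<open>prime p\<close> by (auto simp: prime_nat_iff)
qed

lemma (in group) ord_eq_twice_prime:
  assumes x: "x \<in> carrier G" and "x [^] (2 * p) = \<one>" "x [^] p \<noteq> \<one>" "x [^] (2::nat) \<noteq> \<one>"
    and p: "prime (p::nat)"
  shows "ord x = 2 * p"
proof -
  have "ord x dvd 2 * p" "\<not> ord x dvd p" "\<not> ord x dvd 2"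
    using assms pow_eq_id by blast+
  \<comment> \<open>A divisor of \<open>2 p\<close> is a divisor \<open>a\<close> of \<open>2\<close> times a divisor \<open>b\<close> of \<open>p\<close>.\<close>
  then obtain a b where ab: "ord x = a * b" "a dvd 2" "b dvd p"
    using division_decomp by blast
  have "a = 1 \<or> a = 2" "b = 1 \<or> b = p"
    using ab p two_is_prime_nat by (auto simp: prime_nat_iff)
  then show ?thesis
    using ab \<open>\<not> ord x dvd p\<close> \<open>\<not> ord x dvd 2\<close> by auto
qed

text \<open>
  The powers of \<open>a\<close> already provide \<open>n\<close> roots of \<open>x^n - 1\<close>, and a polynomial of degree \<open>n\<close> over a
  field has no room for further ones.
\<close>

lemma (in field) generate_eq_roots_of_unity:
  assumes fin: "finite (carrier R)" and a: "a \<in> carrier (mult_of R)"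
    and ord: "group.ord (mult_of R) a = n"
  shows "generate (mult_of R) {a} = {x \<in> carrier (mult_of R). x [^]\<^bsub>mult_of R\<^esub> n = \<one>}"
proof -
  interpret G: group "mult_of R" by (rule field_mult_group)
  have fin': "finite (carrier (mult_of R))" using fin by simp
  have n: "n \<noteq> 0" using G.ord_ge_1[OF fin' a] ord by simp
  let ?U = "{x \<in> carrier (mult_of R). x [^]\<^bsub>mult_of R\<^esub> n = \<one>}"
  have sub: "generate (mult_of R) {a} \<subseteq> ?U"
  proof
    fix x assume "x \<in> generate (mult_of R) {a}"
    then obtain k :: nat where x: "x = a [^]\<^bsub>mult_of R\<^esub> k"
      using G.generate_pow_on_finite_carrier[OF fin' a] by blast
    have "G.ord a dvd k * n" using ord by simp
    then have "a [^]\<^bsub>mult_of R\<^esub> (k * n) = \<one>"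
      using G.pow_eq_id[OF a, of "k * n"] by simp
    then have "x [^]\<^bsub>mult_of R\<^esub> n = \<one>"
      using G.nat_pow_pow[OF a, of k n] x by simp
    then show "x \<in> ?U" using G.nat_pow_closed[OF a, of k] x by blast
  qed
  have "card ?U \<le> card {x \<in> carrier R. x [^] n = \<one>}"
    using fin by (intro card_mono) (auto simp: nat_pow_mult_of)
  also have "\<dots> \<le> n" by (rule num_roots_le_deg[OF fin n])
  also have "n = card (generate (mult_of R) {a})"
    using G.generate_pow_card[OF a] ord by simp
  finally show ?thesis
    using card_seteq[OF _ sub] fin' by auto
qed

section \<open>Integers in a field of prime order\<close>

context ring
begin

lemma int_elem_closed [simp, intro]: "int_elem R k \<in> carrier R"
  by (simp add: int_elem_def)

lemma int_elem_1 [simp]: "int_elem R 1 = \<one>"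
  by (simp add: int_elem_def add_pow_def int_pow_def nat_pow_def)

lemma int_elem_add: "int_elem R (a + b) = int_elem R a \<oplus> int_elem R b"
  by (simp add: int_elem_def add.int_pow_mult)

lemma int_elem_mult: "int_elem R (a * b) = int_elem R a \<otimes> int_elem R b"
  by (simp add: int_elem_def add_pow_ldistr_int add.int_pow_pow mult.commute)

end

text \<open>
  The additive order of \<open>1\<close> divides the prime order of the field and differs from \<open>1\<close>, so the
  characteristic is that prime.
\<close>

lemma (in field) int_elem_eq_zero_iff:
  assumes p: "prime (order R)"
  shows "int_elem R k = \<zero> \<longleftrightarrow> int (order R) dvd k"
proof -
  have "group.ord (add_monoid R) \<one> dvd order R"
    using add.ord_dvd_group_order[of \<one>] by (simp add: order_def)
  moreover have "group.ord (add_monoid R) \<one> \<noteq> 1"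
    using add.ord_eq_1[of \<one>] by simp
  ultimately have "group.ord (add_monoid R) \<one> = order R"
    using p by (auto simp: prime_nat_iff)
  then show ?thesis
    using add.int_pow_eq_id[of \<one> k] by (simp add: int_elem_def)
qed

lemma (in field) int_elem_eq_one_iff:
  assumes "prime (order R)"
  shows "int_elem R k = \<one> \<longleftrightarrow> int (order R) dvd k - 1"
proof -
  have "int_elem R k = int_elem R (k - 1) \<oplus> \<one>"
    using int_elem_add[of "k - 1" 1] by simp
  then show ?thesis
    using int_elem_eq_zero_iff[OF assms, of "k - 1"]
    by (metis add.r_cancel_one' int_elem_closed one_closed)
qed

section \<open>The quadratic character of two\<close>

lemma (in field) minus_one_odd_power:
  assumes "odd (n::nat)"
  shows "(\<ominus> \<one>) [^] n = \<ominus> \<one>"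
proof -
  obtain m where n: "n = 2 * m + 1" using assms by (elim oddE)
  have "(\<ominus> \<one>) [^] (2::nat) = \<one>"
    by (simp add: numeral_2_eq_2 l_minus)
  then have "(\<ominus> \<one>) [^] (2 * m) = \<one>"
    by (simp flip: nat_pow_pow)
  then show ?thesis by (simp add: n)
qed

text \<open>
  At most \<open>2 n\<close> of the \<open>4 n\<close> units are \<open>2 n\<close>-th roots of unity. For any other unit \<open>x\<close>, the power
  \<open>x^(2 n)\<close> is a square root of \<open>1\<close> different from \<open>1\<close>, so \<open>x^n\<close> is a square root of \<open>-1\<close>.
\<close>

lemma (in field) exists_sqrt_minus_one:
  assumes fin: "finite (carrier R)" and ord: "order R = 4 * n + 1" and n: "0 < n"
  obtains i where "i \<in> carrier R" "i \<otimes> i = \<ominus> \<one>"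
proof -
  interpret G: group "mult_of R" by (rule field_mult_group)
  let ?U = "{x \<in> carrier R. x [^] (2 * n) = \<one>}"
  have "\<not> carrier (mult_of R) \<subseteq> ?U"
  proof
    assume "carrier (mult_of R) \<subseteq> ?U"
    then have "card (carrier (mult_of R)) \<le> card ?U"
      using fin by (intro card_mono) auto
    also have "\<dots> \<le> 2 * n" using num_roots_le_deg[OF fin] n by simp
    finally show False using order_mult_of[OF fin] ord n by (simp add: order_def)
  qed
  then obtain x where x: "x \<in> carrier (mult_of R)" "x [^] (2 * n) \<noteq> \<one>" by auto
  then have xR: "x \<in> carrier R" by simp
  define y where "y = x [^] (2 * n)"
  have yR: "y \<in> carrier R" using xR by (simp add: y_def)
  have "x [^] (4 * n) = \<one>"
    using G.pow_order_eq_1[OF x(1)] order_mult_of[OF fin] ord by (simp add: nat_pow_mult_of)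
  moreover have "y \<otimes> y = x [^] (4 * n)"
    using xR by (simp add: y_def nat_pow_mult flip: mult_2)
  ultimately have "y \<otimes> y = \<one>" by simp
  then have "y = \<one> \<or> y = \<ominus> \<one>" using square_eq_one yR by blast
  then have "x [^] (2 * n) = \<ominus> \<one>" using x(2) by (simp add: y_def)
  then have "x [^] n \<otimes> x [^] n = \<ominus> \<one>"
    using xR by (simp add: nat_pow_mult flip: mult_2)
  then show thesis using that xR by blast
qed

text \<open>
  With \<open>i^2 = -1\<close> one has \<open>2 i = (1 + i)^2\<close>, whose \<open>2 n\<close>-th power is \<open>1\<close> because the unit group has
  order \<open>4 n\<close>; on the other side \<open>i^(2 n) = (-1)^n = -1\<close>.
\<close>

lemma (in field) four_pow_eq_minus_one:
  assumes fin: "finite (carrier R)" and ord: "order R = 4 * n + 1" and n: "odd n"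
    and p: "prime (order R)"
  shows "int_elem R 4 [^] n = \<ominus> \<one>"
proof -
  interpret G: group "mult_of R" by (rule field_mult_group)
  have n0: "0 < n" using n by (rule odd_pos)
  obtain i where i: "i \<in> carrier R" "i \<otimes> i = \<ominus> \<one>"
    using exists_sqrt_minus_one[OF fin ord n0] .
  define two where "two = int_elem R 2"
  have two: "two \<in> carrier R" by (simp add: two_def)
  have two': "two = \<one> \<oplus> \<one>" using int_elem_add[of 1 1] by (simp add: two_def)
  have four: "int_elem R 4 = two \<otimes> two" using int_elem_mult[of 2 2] by (simp add: two_def)
  have "two \<noteq> \<zero>"
    using int_elem_eq_zero_iff[OF p, of 2] ord n0 zdvd_imp_le[of "int (order R)" 2]
    by (auto simp: two_def)
  have "i \<noteq> \<zero>"
    using i by (metis l_null local.minus_minus minus_zero one_closed one_not_zero)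
  define z where "z = \<one> \<oplus> i"
  have z: "z \<in> carrier R" using i by (simp add: z_def)
  have "z \<otimes> z = (\<one> \<oplus> i \<otimes> i) \<oplus> (i \<oplus> i)"
    using i(1) by (simp add: z_def l_distr r_distr a_ac)
  also have "\<dots> = two \<otimes> i"
    using i by (simp add: two' l_distr r_neg)
  finally have zz: "z \<otimes> z = two \<otimes> i" .
  have "z \<noteq> \<zero>"
    using zz \<open>two \<noteq> \<zero>\<close> \<open>i \<noteq> \<zero>\<close> integral[of two i] i(1) two by auto
  then have z1: "z [^] (4 * n) = \<one>"
    using G.pow_order_eq_1[of z] order_mult_of[OF fin] ord z by (simp add: nat_pow_mult_of)
  have sq: "x [^] (2 * m) = (x \<otimes> x) [^] m" if "x \<in> carrier R" for x and m :: nat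
    using nat_pow_pow[OF that, of 2 m] that by (simp add: numeral_2_eq_2)
  have "\<one> = (z \<otimes> z) [^] (2 * n)"
    using sq[OF z, of "2 * n"] z1 by simp
  also have "\<dots> = two [^] (2 * n) \<otimes> i [^] (2 * n)"
    using two i by (simp add: zz nat_pow_distrib)
  also have "\<dots> = int_elem R 4 [^] n \<otimes> \<ominus> \<one>"
    using two i minus_one_odd_power[OF n] by (simp add: sq four)
  also have "\<dots> = \<ominus> (int_elem R 4 [^] n)"
    by (simp add: r_minus)
  finally have "\<one> = \<ominus> (int_elem R 4 [^] n)" .
  then show ?thesis by (metis int_elem_closed minus_minus nat_pow_closed)
qed

text \<open>
  Raising \<open>4 n = -1\<close> to the \<open>n\<close>-th power gives \<open>4^n n^n = -1\<close>, and the two signs cancel.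
\<close>

lemma (in field) self_pow_eq_one:
  assumes fin: "finite (carrier R)" and ord: "order R = 4 * n + 1" and n: "odd n"
    and p: "prime (order R)"
  shows "int_elem R (int n) [^] n = \<one>"
proof -
  let ?T = "int_elem R (int n)"
  have "int_elem R 4 \<otimes> ?T \<oplus> \<one> = int_elem R (int (order R))"
    by (simp add: ord int_elem_add int_elem_mult a_comm)
  also have "\<dots> = \<zero>" using int_elem_eq_zero_iff[OF p] by simp
  finally have "int_elem R 4 \<otimes> ?T = \<ominus> \<one>"
    by (simp add: minus_equality)
  then have "int_elem R 4 [^] n \<otimes> ?T [^] n = \<ominus> \<one>"
    by (simp add: minus_one_odd_power[OF n] flip: nat_pow_distrib)
  then have "\<ominus> (?T [^] n) = \<ominus> \<one>"
    using four_pow_eq_minus_one[OF assms] by (simp add: l_minus)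
  then show ?thesis by (metis int_elem_closed minus_minus nat_pow_closed one_closed)
qed

section \<open>Squares and elements of odd order\<close>

lemma (in field) odd_order_elements_eq_roots_of_unity:
  assumes fin: "finite (carrier R)" and ord: "order R = 4 * n + 1" and n: "odd n"
  shows "odd_order_elements R = {x \<in> carrier (mult_of R). x [^]\<^bsub>mult_of R\<^esub> n = \<one>}"
proof -
  interpret G: group "mult_of R" by (rule field_mult_group)
  have "odd (G.ord x) \<longleftrightarrow> G.ord x dvd n" if "x \<in> carrier (mult_of R)" for x
  proof
    assume "odd (G.ord x)"
    then have "coprime (G.ord x) (2 ^ 2)"
      by (simp only: coprime_power_right_iff coprime_right_2_iff_odd simp_thms)
    moreover have "G.ord x dvd 2 ^ 2 * n"
      using G.ord_dvd_group_order[OF that] order_mult_of[OF fin] ord by simp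
    ultimately show "G.ord x dvd n" using coprime_dvd_mult_right_iff by blast
  next
    assume "G.ord x dvd n"
    then show "odd (G.ord x)" using n dvd_trans by blast
  qed
  then show ?thesis
    using G.pow_eq_id by (auto simp: odd_order_elements_def)
qed

text \<open>
  Squares are \<open>m\<close>-th roots of unity when the unit group has order \<open>2 m\<close>; conversely, a square of
  order \<open>m\<close> generates all these roots of unity, and its powers are squares.
\<close>

lemma (in field) nonzero_squares_eq_roots_of_unity:
  assumes fin: "finite (carrier R)" and ord: "order R = 2 * m + 1"
    and a: "a \<in> nonzero_squares R" "group.ord (mult_of R) a = m"
  shows "nonzero_squares R = {x \<in> carrier (mult_of R). x [^]\<^bsub>mult_of R\<^esub> m = \<one>}"
    and "nonzero_squares R = generate (mult_of R) {a}"
proof -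
  interpret G: group "mult_of R" by (rule field_mult_group)
  have fin': "finite (carrier (mult_of R))" using fin by simp
  obtain b where b: "b \<in> carrier (mult_of R)" "a = b [^]\<^bsub>mult_of R\<^esub> (2::nat)"
    using a(1) by (auto simp: nonzero_squares_def)
  have aG: "a \<in> carrier (mult_of R)" using G.nat_pow_closed b by blast
  let ?U = "{x \<in> carrier (mult_of R). x [^]\<^bsub>mult_of R\<^esub> m = \<one>}"
  have U: "generate (mult_of R) {a} = ?U"
    by (rule generate_eq_roots_of_unity[OF fin aG a(2)])
  have "nonzero_squares R \<subseteq> ?U"
  proof
    fix x assume "x \<in> nonzero_squares R"
    then obtain c where c: "c \<in> carrier (mult_of R)" "x = c [^]\<^bsub>mult_of R\<^esub> (2::nat)"
      by (auto simp: nonzero_squares_def)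
    have "x [^]\<^bsub>mult_of R\<^esub> m = c [^]\<^bsub>mult_of R\<^esub> (2 * m)"
      using G.nat_pow_pow[OF c(1), of 2 m] c(2) by simp
    also have "\<dots> = \<one>"
      using G.pow_order_eq_1[OF c(1)] order_mult_of[OF fin] ord by simp
    finally show "x \<in> ?U" using G.nat_pow_closed[OF c(1), of 2] c(2) by blast
  qed
  moreover have "generate (mult_of R) {a} \<subseteq> nonzero_squares R"
  proof
    fix x assume "x \<in> generate (mult_of R) {a}"
    then obtain k :: nat where "x = a [^]\<^bsub>mult_of R\<^esub> k"
      using G.generate_pow_on_finite_carrier[OF fin' aG] by blast
    then have "x = (b [^]\<^bsub>mult_of R\<^esub> k) [^]\<^bsub>mult_of R\<^esub> (2::nat)"
      using G.nat_pow_pow[OF b(1), of 2 k] G.nat_pow_pow[OF b(1), of k 2] b(2)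
      by (simp add: mult.commute)
    then show "x \<in> nonzero_squares R"
      using G.nat_pow_closed[OF b(1), of k] unfolding nonzero_squares_def by blast
  qed
  ultimately show "nonzero_squares R = ?U" "nonzero_squares R = generate (mult_of R) {a}"
    using U by auto
qed

theorem theorem4p4:
  fixes F :: "('a, 'b) ring_scheme" and q t :: nat
  assumes "field F" and "finite (carrier F)" and "order F = q"
    and "prime q" and "odd q" and "prime t" and "odd t"
    and "q = 4 * t + 1"
  shows "int_elem F (int t) \<in> nonzero_squares F
    \<and> (\<forall>s \<in> carrier (mult_of F).
         s [^]\<^bsub>mult_of F\<^esub> (2::nat) = int_elem F (int t) \<longrightarrow> s \<in> nonzero_squares F)
    \<and> odd_order_elements F = generate (mult_of F) {int_elem F (int t)}
    \<and> (q > 13 \<longrightarrow>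
         nonzero_squares F = generate (mult_of F) {int_elem F 4}
         \<and> odd_order_elements F = generate (mult_of F) {int_elem F 16})"
proof -
  interpret field F by fact
  interpret G: group "mult_of F" by (rule field_mult_group)
  note fin = \<open>finite (carrier F)\<close>
  have ordF: "order F = 4 * t + 1" and p: "prime (order F)" using assms by auto
  have t3: "3 \<le> t"
    using prime_ge_2_nat[OF \<open>prime t\<close>] \<open>odd t\<close> by (cases "t = 2") auto
  let ?T = "int_elem F (int t)"
  have unit: "int_elem F k \<in> carrier (mult_of F)" if "0 < k" "k < int q" for k
    using that int_elem_eq_zero_iff[OF p, of k] assms zdvd_imp_le[of "int q" k] by auto
  have sixteen: "int_elem F 16 \<noteq> \<one>\<^bsub>F\<^esub>"
  proof
    assume "int_elem F 16 = \<one>\<^bsub>F\<^esub>"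
    then have dvd: "q dvd 15"
      using int_elem_eq_one_iff[OF p, of 16] \<open>order F = q\<close> int_dvd_int_iff[of q 15] by simp
    then have "q \<le> 15" by (rule dvd_imp_le) simp
    \<comment> \<open>As \<open>q = 4 t + 1\<close> with \<open>t\<close> at least \<open>3\<close>, only \<open>q = 13\<close> remains, which does not divide \<open>15\<close>.\<close>
    then have "q = 13" using t3 assms by presburger
    with dvd show False by simp
  qed
  have TG: "?T \<in> carrier (mult_of F)" using unit t3 assms by simp
  have T1: "?T [^]\<^bsub>mult_of F\<^esub> t = \<one>\<^bsub>F\<^esub>"
    using self_pow_eq_one[OF fin ordF \<open>odd t\<close> p] by (simp add: nat_pow_mult_of)
  have "?T \<noteq> \<one>\<^bsub>F\<^esub>"
    using int_elem_eq_one_iff[OF p, of "int t"] t3 ordF zdvd_imp_le[of "int (order F)" "int t - 1"]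
    by auto
  then have ordT: "G.ord ?T = t"
    using G.ord_eq_prime[OF TG] T1 \<open>prime t\<close> by simp
  have fourG: "int_elem F 4 \<in> carrier (mult_of F)" using unit t3 assms by simp
  have four_t: "int_elem F 4 [^]\<^bsub>F\<^esub> t = \<ominus>\<^bsub>F\<^esub> \<one>\<^bsub>F\<^esub>"
    by (rule four_pow_eq_minus_one[OF fin ordF \<open>odd t\<close> p])
  have four_2: "int_elem F 4 [^]\<^bsub>F\<^esub> (2::nat) = int_elem F 16"
    using int_elem_mult[of 4 4] by (simp add: numeral_2_eq_2)
  have four_2t: "int_elem F 4 [^]\<^bsub>F\<^esub> (2 * t) = \<one>\<^bsub>F\<^esub>"
  proof -
    have "int_elem F 4 [^]\<^bsub>F\<^esub> (t * 2) = (\<ominus>\<^bsub>F\<^esub> \<one>\<^bsub>F\<^esub>) [^]\<^bsub>F\<^esub> (2::nat)"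
      using nat_pow_pow[of "int_elem F 4" t 2] four_t by simp
    also have "\<dots> = \<one>\<^bsub>F\<^esub>" by (simp add: numeral_2_eq_2 l_minus)
    finally show ?thesis by (simp add: mult.commute)
  qed
  have "\<ominus>\<^bsub>F\<^esub> \<one>\<^bsub>F\<^esub> \<noteq> \<one>\<^bsub>F\<^esub>"
  proof
    assume "\<ominus>\<^bsub>F\<^esub> \<one>\<^bsub>F\<^esub> = \<one>\<^bsub>F\<^esub>"
    then have "int_elem F 2 = \<zero>\<^bsub>F\<^esub>"
      using int_elem_add[of 1 1] l_neg[OF one_closed] by (metis int_elem_1 one_add_one)
    then show False using unit[of 2] t3 assms by simp
  qed
  then have ord4: "G.ord (int_elem F 4) = 2 * t"
    using G.ord_eq_twice_prime[OF fourG, of t] four_t four_2 four_2t sixteen \<open>prime t\<close>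
    by (simp add: nat_pow_mult_of)
  have "int_elem F 2 [^]\<^bsub>mult_of F\<^esub> (2::nat) = int_elem F 4"
    using int_elem_mult[of 2 2] by (simp add: nat_pow_mult_of numeral_2_eq_2)
  moreover have "int_elem F 2 \<in> carrier (mult_of F)" using unit t3 assms by simp
  ultimately have sq4: "int_elem F 4 \<in> nonzero_squares F"
    unfolding nonzero_squares_def mem_Collect_eq by metis
  have "order F = 2 * (2 * t) + 1" using ordF by simp
  note squares = nonzero_squares_eq_roots_of_unity[OF fin this sq4 ord4]
  have sixteenG: "int_elem F 16 \<in> carrier (mult_of F)"
    using G.nat_pow_closed[OF fourG, of 2] four_2 by (simp add: nat_pow_mult_of)
  have "int_elem F 16 [^]\<^bsub>mult_of F\<^esub> t = \<one>\<^bsub>F\<^esub>"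
    using nat_pow_pow[of "int_elem F 4" 2 t] four_2 four_2t by (simp add: nat_pow_mult_of)
  then have ord16: "G.ord (int_elem F 16) = t"
    using G.ord_eq_prime[OF sixteenG] sixteen \<open>prime t\<close> by simp
  note odds = odd_order_elements_eq_roots_of_unity[OF fin ordF \<open>odd t\<close>]
  have "?T [^]\<^bsub>mult_of F\<^esub> (2 * t) = \<one>\<^bsub>F\<^esub>"
    using G.pow_eq_id[OF TG, of "2 * t"] ordT by simp
  then have "?T \<in> nonzero_squares F" using squares(1) TG by blast
  moreover have "s \<in> nonzero_squares F"
    if s: "s \<in> carrier (mult_of F)" "s [^]\<^bsub>mult_of F\<^esub> (2::nat) = ?T" for s
  proof -
    have "s [^]\<^bsub>mult_of F\<^esub> (2 * t) = \<one>\<^bsub>F\<^esub>"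
      using G.nat_pow_pow[OF s(1), of 2 t] s(2) T1 by simp
    then show ?thesis using squares(1) s(1) by blast
  qed
  moreover have "odd_order_elements F = generate (mult_of F) {?T}"
    using generate_eq_roots_of_unity[OF fin TG ordT] odds by simp
  moreover have "odd_order_elements F = generate (mult_of F) {int_elem F 16}"
    using generate_eq_roots_of_unity[OF fin sixteenG ord16] odds by simp
  ultimately show ?thesis using squares(2) by blast
qed

end
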